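(* Let $m\ge 1$ be an integer, $I=\{1,\ldots,m\}$, let $(T_i)_{i\in I}$ be a family of firmly nonexpansive mappings $T_i\colon X\to X$, let $(\lambda_i)_{i\in I}$ be a family of strictly positive real numbers such that $\sum_{i\in I}\lambda_i=1$, and let $j\in I$. Set $T=\sum_{i\in I}\lambda_iT_i$. Then the following hold. (i) $T$ is firmly nonexpansive, $\operatorname{ran}T$ is nearly convex, and $\operatorname{ran}T\approx\sum_{i\in I}\lambda_i\operatorname{ran}T_i$. (ii) If $T_j$ is surjective, then $T$ is surjective. (iii) If $0\in\bigcap_{i\in I}\overline{\operatorname{ran}T_i}$, then $0\in\overline{\operatorname{ran}T}$. (iv) If $0\in(\operatorname{int}\operatorname{ran}T_j)\cap\bigcap_{i\in I\setminus\{j\}}\overline{\operatorname{ran}T_i}$, then $0\in\operatorname{int}\operatorname{ran}T$.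
   Context: $X$ is a real Euclidean space (finite-dimensional real inner product space) with inner product $\langle\cdot,\cdot\rangle$ and induced norm $\|\cdot\|$. A mapping $T\colon X\to X$ is firmly nonexpansive if $\langle x-y,Tx-Ty\rangle\ge\|Tx-Ty\|^2$ for all $x,y\in X$. $\operatorname{ran}T$ is the range of $T$. For $C\subseteq X$, $\overline C$ is the closure, $\operatorname{int}C$ the interior, and $\operatorname{ri}C$ the relative interior, i.e., the interior of $C$ relative to its affine hull $\operatorname{aff}C$. Sums and scalar multiples of sets are Minkowski sums and pointwise multiples. Subsets $A,B$ of $X$ are nearly equal, written $A\approx B$, if $\overline A=\overline B$ and $\operatorname{ri}A=\operatorname{ri}B$. A subset $A$ of $X$ is nearly convex if there exists a convex set $C\subseteq X$ such that $C\subseteq A\subseteq\overline C$. *)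

theory Defs
  imports "HOL-Analysis.Analysis"
begin

definition firmly_nonexpansive :: "('a::real_inner \<Rightarrow> 'a) \<Rightarrow> bool"
  where "firmly_nonexpansive T \<longleftrightarrow>
    (\<forall>x y. (x - y) \<bullet> (T x - T y) \<ge> (norm (T x - T y))\<^sup>2)"

definition nearly_equal :: "'a::euclidean_space set \<Rightarrow> 'a set \<Rightarrow> bool"
  where "nearly_equal A B \<longleftrightarrow> closure A = closure B \<and> rel_interior A = rel_interior B"

definition nearly_convex :: "'a::euclidean_space set \<Rightarrow> bool"
  where "nearly_convex A \<longleftrightarrow> (\<exists>C. convex C \<and> C \<subseteq> A \<and> A \<subseteq> closure C)"

end

theory Submission
  imports Defs
begin

text \<open>
  Write \<open>S\<close> for the Minkowski sum of the sets \<open>\<lambda>\<^sub>i ran T\<^sub>i\<close> and \<open>T\<close> for the averaged map. All four claims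
  come from the chain of inclusions
  \<open>ri (conv S) \<subseteq> ran T \<subseteq> S \<subseteq> conv S\<close>.
  Since a convex set and its relative interior have the same closure, the same affine hull and the
  same relative interior, every set squeezed between them is nearly convex, and any two such sets
  are nearly equal. With Jensen's inequality for the firm nonexpansiveness of \<open>T\<close>, this is (i). The
  chain also gives \<open>interior S \<subseteq> ran T\<close> and \<open>closure S = closure (ran T)\<close>. So in (ii) and (iv) it
  remains to see that the points in question are interior to \<open>S\<close>, and in (iii) that \<open>0\<close> lies in
  \<open>closure S\<close>; these are elementary facts about Minkowski sums.

  Only the inclusion \<open>ri (conv S) \<subseteq> ran T\<close> has content. It is a Brezis-Haraux argument. A firmly
  nonexpansive map \<open>F\<close> is rectangular: for each \<open>v \<in> ran F\<close> the function \<open>x \<mapsto> x \<bullet> (F x - v)\<close> is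
  bounded below (\<open>dominated_point_range\<close>). Adding up, the averaged map \<open>T\<close> has this property for each
  \<open>v \<in> S\<close>, and the set of all such \<open>v\<close> is convex, so it contains \<open>conv S\<close>. Now take
  \<open>w \<in> ri (conv S)\<close>. By Banach's fixed point theorem there is, for each \<open>\<epsilon> > 0\<close>, a point \<open>x\<close> with
  \<open>\<epsilon> x + T x = w\<close> (\<open>regularized_equation_solvable\<close>). For \<open>v \<in> conv S\<close> the lower bound for \<open>v\<close> then
  gives an upper bound for \<open>x \<bullet> (v - w)\<close> that does not depend on \<open>\<epsilon>\<close>. Since \<open>w\<close> is in the relative
  interior, \<open>v - w\<close> may be any small multiple of any direction parallel to \<open>aff S\<close>; and \<open>x\<close> itself
  is such a direction. Hence the points \<open>x\<close> stay bounded as \<open>\<epsilon> \<rightarrow> 0\<close>, and every cluster point \<open>x\<close> of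
  them solves \<open>T x = w\<close> (\<open>rel_interior_subset_range\<close>).
\<close>

section \<open>Firmly nonexpansive maps\<close>

lemma firmly_nonexpansive_nonexpansive:
  assumes "firmly_nonexpansive T"
  shows "norm (T x - T y) \<le> norm (x - y)"
proof -
  have "norm (T x - T y) * norm (T x - T y) \<le> norm (x - y) * norm (T x - T y)"
    using assms norm_cauchy_schwarz[of "x - y" "T x - T y"]
    unfolding firmly_nonexpansive_def power2_eq_square by (meson order_trans)
  then show ?thesis
    by (metis mult_le_cancel_right norm_ge_zero order_less_le)
qed

lemma firmly_nonexpansive_residual_nonexpansive:
  assumes "firmly_nonexpansive T"
  shows "norm ((x - T x) - (y - T y)) \<le> norm (x - y)"
proof -
  define a b where "a = x - y" and "b = T x - T y"
  have "a \<bullet> b \<ge> b \<bullet> b"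
    using assms by (simp add: firmly_nonexpansive_def a_def b_def power2_norm_eq_inner)
  moreover have "b \<bullet> b \<ge> 0"
    by simp
  moreover have "(a - b) \<bullet> (a - b) = a \<bullet> a - 2 * (a \<bullet> b) + b \<bullet> b"
    by (simp add: inner_diff_left inner_diff_right inner_commute)
  ultimately have "(a - b) \<bullet> (a - b) \<le> a \<bullet> a"
    by linarith
  moreover have "(x - T x) - (y - T y) = a - b"
    by (simp add: a_def b_def)
  ultimately show ?thesis
    by (simp only: norm_le a_def)
qed

lemma firmly_nonexpansive_continuous:
  assumes "firmly_nonexpansive T"
  shows "continuous_on S T"
  using firmly_nonexpansive_nonexpansive[OF assms]
  by (auto simp: continuous_on_iff dist_norm intro: le_less_trans)

text \<open>Jensen's inequality for the squared norm, in the form of a nonnegative variance.\<close>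

lemma norm_squared_convex_combination:
  fixes d :: "'i \<Rightarrow> 'a::real_inner"
  assumes "\<And>i. i \<in> I \<Longrightarrow> lam i \<ge> 0" and "(\<Sum>i\<in>I. lam i) = 1"
  shows "(norm (\<Sum>i\<in>I. lam i *\<^sub>R d i))\<^sup>2 \<le> (\<Sum>i\<in>I. lam i * (norm (d i))\<^sup>2)"
proof -
  define c where "c = (\<Sum>i\<in>I. lam i *\<^sub>R d i)"
  have "0 \<le> (\<Sum>i\<in>I. lam i * ((d i - c) \<bullet> (d i - c)))"
    using assms(1) by (intro sum_nonneg mult_nonneg_nonneg) auto
  also have "\<dots> = (\<Sum>i\<in>I. lam i * (d i \<bullet> d i) - 2 * ((lam i *\<^sub>R d i) \<bullet> c) + lam i * (c \<bullet> c))"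
    by (intro sum.cong refl) (simp add: algebra_simps inner_commute)
  also have "\<dots> = (\<Sum>i\<in>I. lam i * (d i \<bullet> d i)) - 2 * (c \<bullet> c) + c \<bullet> c"
    unfolding sum.distrib sum_subtractf sum_distrib_left[symmetric] sum_distrib_right[symmetric]
      inner_sum_left[symmetric] c_def[symmetric] assms(2) by simp
  finally show ?thesis
    by (simp add: c_def power2_norm_eq_inner)
qed

lemma firmly_nonexpansive_convex_combination:
  fixes T :: "'i \<Rightarrow> 'a::real_inner \<Rightarrow> 'a"
  assumes "\<And>i. i \<in> I \<Longrightarrow> firmly_nonexpansive (T i)"
    and "\<And>i. i \<in> I \<Longrightarrow> lam i \<ge> 0" and "(\<Sum>i\<in>I. lam i) = 1"
  shows "firmly_nonexpansive (\<lambda>x. \<Sum>i\<in>I. lam i *\<^sub>R T i x)"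
  unfolding firmly_nonexpansive_def
proof (intro allI)
  fix x y
  have diff: "(\<Sum>i\<in>I. lam i *\<^sub>R T i x) - (\<Sum>i\<in>I. lam i *\<^sub>R T i y)
      = (\<Sum>i\<in>I. lam i *\<^sub>R (T i x - T i y))"
    by (simp add: sum_subtractf scaleR_diff_right)
  have "(norm (\<Sum>i\<in>I. lam i *\<^sub>R (T i x - T i y)))\<^sup>2
      \<le> (\<Sum>i\<in>I. lam i * (norm (T i x - T i y))\<^sup>2)"
    using norm_squared_convex_combination[of I lam "\<lambda>i. T i x - T i y"] assms(2,3) by blast
  also have "\<dots> \<le> (\<Sum>i\<in>I. lam i * ((x - y) \<bullet> (T i x - T i y)))"
    using assms(1,2) by (intro sum_mono mult_left_mono) (auto simp: firmly_nonexpansive_def)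
  also have "\<dots> = (x - y) \<bullet> (\<Sum>i\<in>I. lam i *\<^sub>R (T i x - T i y))"
    by (simp add: inner_sum_right)
  finally show "(norm ((\<Sum>i\<in>I. lam i *\<^sub>R T i x) - (\<Sum>i\<in>I. lam i *\<^sub>R T i y)))\<^sup>2
      \<le> (x - y) \<bullet> ((\<Sum>i\<in>I. lam i *\<^sub>R T i x) - (\<Sum>i\<in>I. lam i *\<^sub>R T i y))"
    by (simp add: diff)
qed

section \<open>Rectangularity\<close>

text \<open>
  Rectangularity of \<open>T\<close> asks that for every \<open>y\<close> and \<open>v \<in> ran T\<close> the function
  \<open>x \<mapsto> (x - y) \<bullet> (T x - v)\<close> is bounded below. Fixing \<open>y = 0\<close> and collecting all vectors \<open>v\<close> with this
  property, in the range or not, gives a convex set; so it contains the convex hull of the range as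
  soon as it contains the range.
\<close>

definition dominated_points :: "('a::real_inner \<Rightarrow> 'a) \<Rightarrow> 'a set"
  where "dominated_points T = {v. \<exists>K. \<forall>x. x \<bullet> (T x - v) \<ge> - K}"

lemma convex_dominated_points: "convex (dominated_points T)"
proof (rule convexI)
  fix v w and a b :: real
  assume "v \<in> dominated_points T" "w \<in> dominated_points T" and ab: "0 \<le> a" "0 \<le> b" "a + b = 1"
  then obtain K L where K: "\<And>x. x \<bullet> (T x - v) \<ge> - K" and L: "\<And>x. x \<bullet> (T x - w) \<ge> - L"
    by (auto simp: dominated_points_def)
  have "x \<bullet> (T x - (a *\<^sub>R v + b *\<^sub>R w)) \<ge> - (a * K + b * L)" for x
  proof -
    have "T x - (a *\<^sub>R v + b *\<^sub>R w) = a *\<^sub>R (T x - v) + b *\<^sub>R (T x - w)"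
      using ab(3) by (simp add: algebra_simps flip: scaleR_add_left)
    then have "x \<bullet> (T x - (a *\<^sub>R v + b *\<^sub>R w)) = a * (x \<bullet> (T x - v)) + b * (x \<bullet> (T x - w))"
      by (simp add: inner_add_right)
    then show ?thesis
      using mult_left_mono[OF K[of x] ab(1)] mult_left_mono[OF L[of x] ab(2)] by simp
  qed
  then show "a *\<^sub>R v + b *\<^sub>R w \<in> dominated_points T"
    unfolding dominated_points_def by blast
qed

text \<open>
  With \<open>v = T y\<close>, firm nonexpansiveness leaves \<open>d\<^sup>2 - \<parallel>y\<parallel> d\<close> with \<open>d = \<parallel>T x - T y\<parallel>\<close> as a lower bound,
  a quadratic in \<open>d\<close> that is at least \<open>-\<parallel>y\<parallel>\<^sup>2 / 4\<close>.
\<close>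

lemma dominated_point_range:
  assumes "firmly_nonexpansive T"
  shows "T y \<in> dominated_points T"
proof -
  have "x \<bullet> (T x - T y) \<ge> - ((norm y)\<^sup>2 / 4)" for x
  proof -
    define d where "d = norm (T x - T y)"
    have "x \<bullet> (T x - T y) = (x - y) \<bullet> (T x - T y) + y \<bullet> (T x - T y)"
      by (simp add: inner_diff_left)
    moreover have "(x - y) \<bullet> (T x - T y) \<ge> d\<^sup>2"
      using assms by (simp add: firmly_nonexpansive_def d_def)
    moreover have "y \<bullet> (T x - T y) \<ge> - (norm y * d)"
      using Cauchy_Schwarz_ineq2[of y "T x - T y"] by (simp add: d_def)
    moreover have "d\<^sup>2 - norm y * d + (norm y)\<^sup>2 / 4 = (d - norm y / 2)\<^sup>2"
      by (simp add: power2_eq_square algebra_simps)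
    moreover have "(d - norm y / 2)\<^sup>2 \<ge> 0"
      by simp
    ultimately show ?thesis
      by linarith
  qed
  then show ?thesis
    unfolding dominated_points_def by blast
qed

lemma dominated_points_nonneg_combination:
  assumes "\<And>i. i \<in> I \<Longrightarrow> lam i \<ge> 0" and "\<And>i. i \<in> I \<Longrightarrow> v i \<in> dominated_points (T i)"
  shows "(\<Sum>i\<in>I. lam i *\<^sub>R v i) \<in> dominated_points (\<lambda>x. \<Sum>i\<in>I. lam i *\<^sub>R T i x)"
proof -
  obtain K where K: "\<And>i x. i \<in> I \<Longrightarrow> x \<bullet> (T i x - v i) \<ge> - K i"
    using assms(2) unfolding dominated_points_def mem_Collect_eq by metis
  have "x \<bullet> ((\<Sum>i\<in>I. lam i *\<^sub>R T i x) - (\<Sum>i\<in>I. lam i *\<^sub>R v i)) \<ge> - (\<Sum>i\<in>I. lam i * K i)" for x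
  proof -
    have "- (\<Sum>i\<in>I. lam i * K i) = (\<Sum>i\<in>I. lam i * - K i)"
      by (simp add: sum_negf)
    also have "\<dots> \<le> (\<Sum>i\<in>I. lam i * (x \<bullet> (T i x - v i)))"
      using assms(1) K by (intro sum_mono mult_left_mono) auto
    also have "\<dots> = x \<bullet> ((\<Sum>i\<in>I. lam i *\<^sub>R T i x) - (\<Sum>i\<in>I. lam i *\<^sub>R v i))"
      by (simp add: inner_sum_right inner_diff_right sum_subtractf right_diff_distrib)
    finally show ?thesis .
  qed
  then show ?thesis
    unfolding dominated_points_def by blast
qed

section \<open>The range of a firmly nonexpansive map\<close>

text \<open>
  Because \<open>id - T\<close> is nonexpansive, \<open>x \<mapsto> (w + (x - T x)) / (1 + \<epsilon>)\<close> is a contraction; its fixed point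
  solves the equation.
\<close>

lemma regularized_equation_solvable:
  fixes T :: "'a::{real_inner, complete_space} \<Rightarrow> 'a"
  assumes "firmly_nonexpansive T" and "\<epsilon> > 0"
  obtains x where "\<epsilon> *\<^sub>R x + T x = w"
proof -
  define f where "f x = (1 / (1 + \<epsilon>)) *\<^sub>R (w + (x - T x))" for x
  have "dist (f x) (f y) \<le> 1 / (1 + \<epsilon>) * dist x y" for x y
  proof -
    have "f x - f y = (1 / (1 + \<epsilon>)) *\<^sub>R ((x - T x) - (y - T y))"
      by (simp add: f_def algebra_simps)
    then have "dist (f x) (f y) = 1 / (1 + \<epsilon>) * norm ((x - T x) - (y - T y))"
      using assms(2) by (simp add: dist_norm)
    also have "\<dots> \<le> 1 / (1 + \<epsilon>) * dist x y"
      unfolding dist_norm using assms(2) firmly_nonexpansive_residual_nonexpansive[OF assms(1)]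
      by (intro mult_left_mono) auto
    finally show ?thesis .
  qed
  then have "\<exists>!x. f x = x"
    using assms(2) by (intro banach_fix_type[where c = "1 / (1 + \<epsilon>)"]) auto
  then obtain x where "f x = x"
    by blast
  then have "(1 + \<epsilon>) *\<^sub>R x = (1 + \<epsilon>) *\<^sub>R f x"
    by simp
  also have "\<dots> = w + (x - T x)"
    using assms(2) by (simp add: f_def)
  finally have "\<epsilon> *\<^sub>R x + T x = w"
    by (simp add: algebra_simps)
  then show thesis
    by (rule that)
qed

text \<open>
  A finite-dimensional uniform boundedness principle: one-sided bounds suffice since \<open>u\<close> and \<open>- u\<close>
  both lie in \<open>V\<close>, and it is enough to use them on an orthonormal basis of \<open>V\<close>.
\<close>

lemma bounded_of_inner_bounded_above:
  fixes X V :: "'a::euclidean_space set"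
  assumes "subspace V" and "X \<subseteq> V"
    and above: "\<And>u. u \<in> V \<Longrightarrow> \<exists>K. \<forall>x\<in>X. x \<bullet> u \<le> K"
  shows "bounded X"
proof -
  obtain B where B: "B \<subseteq> V" "pairwise orthogonal B" "\<And>b. b \<in> B \<Longrightarrow> norm b = 1"
    "independent B" "span B = V"
    using orthonormal_basis_subspace[OF assms(1)] by metis
  have "finite B"
    using B(4) by (rule independent_imp_finite)
  have "\<exists>K. \<forall>x\<in>X. \<bar>x \<bullet> b\<bar> \<le> K" if b: "b \<in> B" for b
  proof -
    have "b \<in> V" "- b \<in> V"
      using b B(1) assms(1) by (auto simp: subspace_neg)
    then obtain K L where K: "\<forall>x\<in>X. x \<bullet> b \<le> K" and L: "\<forall>x\<in>X. x \<bullet> - b \<le> L"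
      using above by meson
    then have "\<forall>x\<in>X. \<bar>x \<bullet> b\<bar> \<le> max K L"
      by fastforce
    then show ?thesis
      by blast
  qed
  then obtain K where K: "\<And>b x. b \<in> B \<Longrightarrow> x \<in> X \<Longrightarrow> \<bar>x \<bullet> b\<bar> \<le> K b"
    by metis
  have "norm x \<le> (\<Sum>b\<in>B. K b)" if x: "x \<in> X" for x
  proof -
    have "x = (\<Sum>b\<in>B. (x \<bullet> b) *\<^sub>R b)"
      using orthonormal_basis_expand[OF B(2,3) _ \<open>finite B\<close>, of x] x assms(2) B(5) by auto
    then have "norm x \<le> (\<Sum>b\<in>B. norm ((x \<bullet> b) *\<^sub>R b))"
      by (metis norm_sum)
    also have "\<dots> \<le> (\<Sum>b\<in>B. K b)"
      using B(3) K x by (intro sum_mono) auto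
    finally show ?thesis .
  qed
  then show ?thesis
    unfolding bounded_iff by blast
qed

text \<open>
  The range theorem of Brezis and Haraux. The solutions of \<open>\<epsilon> x + T x = w\<close> satisfy
  \<open>x = (w - T x) / \<epsilon>\<close>, so they lie in the subspace \<open>V\<close> parallel to the affine hull of \<open>C\<close>. It
  therefore suffices to bound them in the directions of \<open>V\<close>, which is what the relative interior of
  \<open>C\<close> provides.
\<close>

lemma rel_interior_subset_range:
  fixes T :: "'a::euclidean_space \<Rightarrow> 'a"
  assumes T: "firmly_nonexpansive T" and range: "range T \<subseteq> affine hull C"
    and C: "C \<subseteq> dominated_points T"
  shows "rel_interior C \<subseteq> range T"
proof
  fix w assume "w \<in> rel_interior C"
  then obtain e where w: "w \<in> C" and e: "e > 0" "ball w e \<inter> affine hull C \<subseteq> C"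
    by (auto simp: mem_rel_interior_ball)
  define V where "V = span ((\<lambda>x. - w + x) ` (C - {w}))"
  have hull: "affine hull C = (\<lambda>x. w + x) ` V"
    unfolding V_def by (rule affine_hull_span2[OF w])
  have V: "subspace V"
    by (simp add: V_def)
  define X where "X = {x. \<exists>\<epsilon>>0. \<epsilon> *\<^sub>R x + T x = w}"
  have "X \<subseteq> V"
  proof
    fix x assume "x \<in> X"
    then obtain \<epsilon> where eps: "\<epsilon> > 0" "\<epsilon> *\<^sub>R x + T x = w"
      by (auto simp: X_def)
    obtain u where u: "u \<in> V" "T x = w + u"
      using range hull by blast
    have "\<epsilon> *\<^sub>R x = - u"
      using eps(2) u(2) by (simp add: algebra_simps add_eq_0_iff)
    then have "(1 / \<epsilon>) *\<^sub>R (\<epsilon> *\<^sub>R x) = (- (1 / \<epsilon>)) *\<^sub>R u"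
      by simp
    then have "x = (- (1 / \<epsilon>)) *\<^sub>R u"
      using eps(1) by simp
    then show "x \<in> V"
      using V u(1) subspace_scale by blast
  qed
  moreover have "\<exists>K. \<forall>x\<in>X. x \<bullet> u \<le> K" if "u \<in> V" for u
  proof -
    \<comment> \<open>The multiple of \<open>u\<close> by \<open>t\<close> has norm less than \<open>e\<close>, also when \<open>u\<close> is zero.\<close>
    define t where "t = e / (1 + norm u)"
    have n: "1 + norm u > 0"
      by (simp add: add_pos_nonneg)
    then have t: "t > 0"
      using e(1) by (simp add: t_def)
    have "norm (t *\<^sub>R u) < e"
      using n e(1) by (simp add: t_def field_simps)
    moreover have "w + t *\<^sub>R u \<in> affine hull C"
      using V \<open>u \<in> V\<close> hull subspace_scale by blast
    ultimately have "w + t *\<^sub>R u \<in> C"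
      using e(2) by (auto simp: dist_norm)
    then obtain K where K: "\<And>x. x \<bullet> (T x - (w + t *\<^sub>R u)) \<ge> - K"
      using C by (auto simp: dominated_points_def)
    have "x \<bullet> u \<le> K / t" if x: "x \<in> X" for x
    proof -
      obtain \<epsilon> where eps: "\<epsilon> > 0" "\<epsilon> *\<^sub>R x + T x = w"
        using x by (auto simp: X_def)
      have "T x - (w + t *\<^sub>R u) = - (\<epsilon> *\<^sub>R x) - t *\<^sub>R u"
        using eps(2) by (auto simp: algebra_simps)
      then have "x \<bullet> (T x - (w + t *\<^sub>R u)) = - (\<epsilon> * (x \<bullet> x)) - t * (x \<bullet> u)"
        by (simp only: inner_diff_right inner_minus_right inner_scaleR_right)
      then have "- K \<le> - (\<epsilon> * (x \<bullet> x)) - t * (x \<bullet> u)"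
        using K[of x] by simp
      moreover have "\<epsilon> * (x \<bullet> x) \<ge> 0"
        using eps(1) by simp
      ultimately have "t * (x \<bullet> u) \<le> K"
        by linarith
      then show ?thesis
        using t by (simp add: field_simps)
    qed
    then show ?thesis
      by blast
  qed
  ultimately have "bounded X"
    using bounded_of_inner_bounded_above[OF V] by blast
  define eps where "eps n = 1 / real (Suc n)" for n
  have eps_pos: "eps n > 0" for n
    by (simp add: eps_def)
  have "\<forall>n. \<exists>x. eps n *\<^sub>R x + T x = w"
    using regularized_equation_solvable[OF T eps_pos] by blast
  then obtain x where x: "\<And>n. eps n *\<^sub>R x n + T (x n) = w"
    by metis
  then have "range x \<subseteq> X"
    using eps_pos by (auto simp: X_def)
  then have "bounded (range x)"
    using \<open>bounded X\<close> bounded_subset by blast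
  then obtain l r where r: "strict_mono r" "(x \<circ> r) \<longlonglongrightarrow> l"
    using bounded_imp_convergent_subsequence by blast
  have "(\<lambda>n. T (x (r n))) \<longlonglongrightarrow> T l"
    using continuous_on_tendsto_compose[OF firmly_nonexpansive_continuous[OF T, of UNIV] r(2)]
    by (simp add: o_def)
  moreover have "eps \<longlonglongrightarrow> 0"
    unfolding eps_def using LIMSEQ_inverse_real_of_nat by (simp add: inverse_eq_divide)
  then have "(\<lambda>n. eps (r n)) \<longlonglongrightarrow> 0"
    using LIMSEQ_subseq_LIMSEQ[OF _ r(1)] by (auto simp: o_def)
  then have "(\<lambda>n. eps (r n) *\<^sub>R x (r n)) \<longlonglongrightarrow> 0 *\<^sub>R l"
    using r(2) by (intro tendsto_scaleR) (auto simp: o_def)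
  ultimately have "(\<lambda>n. eps (r n) *\<^sub>R x (r n) + T (x (r n))) \<longlonglongrightarrow> 0 *\<^sub>R l + T l"
    by (intro tendsto_add)
  then have "T l = w"
    by (simp add: x LIMSEQ_const_iff)
  then show "w \<in> range T"
    by blast
qed

section \<open>Sets between a convex set and its relative interior\<close>

lemma between_rel_interior_and_convex:
  fixes A C :: "'a::euclidean_space set"
  assumes "convex C" and "rel_interior C \<subseteq> A" and "A \<subseteq> C"
  shows "closure A = closure C" and "rel_interior A = rel_interior C"
proof -
  show closure: "closure A = closure C"
    using closure_mono[OF assms(2)] closure_mono[OF assms(3)]
      convex_closure_rel_interior[OF assms(1)] by auto
  then have hull: "affine hull A = affine hull C"
    by (metis closure_same_affine_hull)
  have "rel_interior (rel_interior C) \<subseteq> rel_interior A"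
    using assms(1,2) hull by (intro subset_rel_interior) (auto simp: rel_interior_same_affine_hull)
  then show "rel_interior A = rel_interior C"
    using subset_rel_interior[OF assms(3) hull] rel_interior_rel_interior[OF assms(1)] by auto
qed

lemma nearly_convex_between:
  fixes A C :: "'a::euclidean_space set"
  assumes "convex C" and "rel_interior C \<subseteq> A" and "A \<subseteq> C"
  shows "nearly_convex A"
  unfolding nearly_convex_def
proof (intro exI conjI)
  show "convex (rel_interior C)"
    using assms(1) by (rule convex_rel_interior)
  show "A \<subseteq> closure (rel_interior C)"
    using assms(3) closure_subset convex_closure_rel_interior[OF assms(1)] by blast
qed (fact assms(2))

section \<open>Minkowski sums\<close>

lemma sum_closure_subset:
  fixes A :: "'i \<Rightarrow> 'a::real_normed_vector set"
  assumes "finite I"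
  shows "(\<Sum>i\<in>I. closure (A i)) \<subseteq> closure (\<Sum>i\<in>I. A i)"
  using assms
proof (induction I rule: finite_induct)
  case empty
  show ?case
    by (simp add: closure_subset)
next
  case (insert i I)
  have "closure (A i) + (\<Sum>i\<in>I. closure (A i)) \<subseteq> closure (A i) + closure (\<Sum>i\<in>I. A i)"
    using insert.IH by (intro set_plus_mono2) auto
  also have "\<dots> \<subseteq> closure (A i + (\<Sum>i\<in>I. A i))"
    by (rule closure_sum)
  finally show ?case
    using insert.hyps by simp
qed

lemma zero_in_closure_scaled_sum:
  fixes A :: "'i \<Rightarrow> 'a::real_normed_vector set"
  assumes "finite I" and "\<And>i. i \<in> I \<Longrightarrow> 0 \<in> closure (A i)"
  shows "0 \<in> closure (\<Sum>i\<in>I. (\<lambda>x. lam i *\<^sub>R x) ` A i)"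
proof -
  have "0 \<in> closure ((\<lambda>x. lam i *\<^sub>R x) ` A i)" if "i \<in> I" for i
    unfolding closure_scaleR[symmetric] using assms(2)[OF that] by force
  then have "(\<Sum>i\<in>I. 0) \<in> (\<Sum>i\<in>I. closure ((\<lambda>x. lam i *\<^sub>R x) ` A i))"
    unfolding set_sum_alt[OF assms(1)] by blast
  then show ?thesis
    using sum_closure_subset[OF assms(1), of "\<lambda>i. (\<lambda>x. lam i *\<^sub>R x) ` A i"] by auto
qed

text \<open>
  The open set \<open>interior A\<close> absorbs the small error made when a point of \<open>closure B\<close> is replaced by a
  nearby point of \<open>B\<close>.
\<close>

lemma interior_plus_closure_subset:
  fixes A B :: "'a::real_normed_vector set"
  shows "interior A + closure B \<subseteq> interior (A + B)"
proof
  fix p assume "p \<in> interior A + closure B"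
  then obtain a b where p: "p = a + b" "a \<in> interior A" "b \<in> closure B"
    by (rule set_plus_elim)
  obtain e where e: "e > 0" "ball a e \<subseteq> interior A"
    using p(2) open_contains_ball open_interior by blast
  obtain b' where b': "b' \<in> B" "dist b' b < e"
    using p(3) e(1) by (auto simp: closure_approachable)
  have "a + b - b' \<in> interior A"
    using e(2) b'(2) by (auto simp: dist_norm norm_minus_commute subset_iff algebra_simps)
  then have "p \<in> (\<Union>x\<in>interior A. \<Union>y\<in>B. {x + y})"
    using b'(1) p(1) by (intro UN_I[of "a + b - b'"] UN_I[of b']) auto
  moreover have "(\<Union>x\<in>interior A. \<Union>y\<in>B. {x + y}) \<subseteq> interior (A + B)"
  proof (rule interior_maximal)
    show "(\<Union>x\<in>interior A. \<Union>y\<in>B. {x + y}) \<subseteq> A + B"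
      using interior_subset by (auto simp: set_plus_def)
    show "open (\<Union>x\<in>interior A. \<Union>y\<in>B. {x + y})"
      by (intro open_sums) simp
  qed
  ultimately show "p \<in> interior (A + B)"
    by blast
qed

section \<open>Ranges of averages\<close>

theorem theorem4p5:
  fixes m j :: nat and I :: "nat set"
    and T :: "nat \<Rightarrow> 'a::euclidean_space \<Rightarrow> 'a"
    and lam :: "nat \<Rightarrow> real"
    and Tavg :: "'a \<Rightarrow> 'a"
  assumes "m \<ge> 1"
    and "I = {1..m}"
    and "\<forall>i\<in>I. firmly_nonexpansive (T i)"
    and "\<forall>i\<in>I. lam i > 0"
    and "(\<Sum>i\<in>I. lam i) = 1"
    and "j \<in> I"
    and "Tavg = (\<lambda>x. \<Sum>i\<in>I. lam i *\<^sub>R T i x)"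
  shows "(firmly_nonexpansive Tavg \<and> nearly_convex (range Tavg) \<and>
           nearly_equal (range Tavg) (\<Sum>i\<in>I. (\<lambda>x. lam i *\<^sub>R x) ` range (T i))) \<and>
         (surj (T j) \<longrightarrow> surj Tavg) \<and>
         (0 \<in> (\<Inter>i\<in>I. closure (range (T i))) \<longrightarrow> 0 \<in> closure (range Tavg)) \<and>
         (0 \<in> interior (range (T j)) \<inter> (\<Inter>i\<in>I - {j}. closure (range (T i)))
           \<longrightarrow> 0 \<in> interior (range Tavg))"
proof -
  define A where "A i = (\<lambda>x. lam i *\<^sub>R x) ` range (T i)" for i
  define S where "S = (\<Sum>i\<in>I. A i)"
  define C where "C = convex hull S"
  have fin: "finite I"
    by (simp add: assms(2))
  have lam: "\<And>i. i \<in> I \<Longrightarrow> lam i \<ge> 0" "lam j > 0"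
    using assms(4,6) by (auto simp: less_imp_le)
  have firm: "firmly_nonexpansive Tavg"
    unfolding assms(7) using assms(3,5) lam(1)
    by (intro firmly_nonexpansive_convex_combination) auto
  have ran_S: "range Tavg \<subseteq> S"
    unfolding S_def set_sum_alt[OF fin] A_def assms(7) by blast
  have S_C: "S \<subseteq> C"
    unfolding C_def by (rule hull_subset)
  have "S \<subseteq> dominated_points Tavg"
  proof
    fix v assume "v \<in> S"
    then obtain s where v: "v = (\<Sum>i\<in>I. s i)" and s: "\<forall>i\<in>I. s i \<in> A i"
      unfolding S_def set_sum_alt[OF fin] by blast
    then have "\<forall>i\<in>I. \<exists>y. s i = lam i *\<^sub>R T i y"
      by (auto simp: A_def)
    then obtain y where "\<And>i. i \<in> I \<Longrightarrow> s i = lam i *\<^sub>R T i (y i)"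
      by metis
    then have "v = (\<Sum>i\<in>I. lam i *\<^sub>R T i (y i))"
      by (simp add: v)
    then show "v \<in> dominated_points Tavg"
      unfolding assms(7)
      using dominated_points_nonneg_combination[of I lam "\<lambda>i. T i (y i)" T] lam(1) assms(3)
        dominated_point_range by blast
  qed
  then have "C \<subseteq> dominated_points Tavg"
    unfolding C_def by (simp add: hull_minimal convex_dominated_points)
  moreover have "range Tavg \<subseteq> affine hull C"
    using ran_S S_C hull_subset[of C affine] by blast
  ultimately have ri_ran: "rel_interior C \<subseteq> range Tavg"
    using firm by (intro rel_interior_subset_range)
  have C: "convex C"
    by (simp add: C_def)
  have ran_C: "range Tavg \<subseteq> C" and ri_S: "rel_interior C \<subseteq> S"
    using ran_S S_C ri_ran by auto
  have near: "nearly_equal (range Tavg) S"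
    unfolding nearly_equal_def
    using between_rel_interior_and_convex[OF C ri_ran ran_C]
      between_rel_interior_and_convex[OF C ri_S S_C] by simp
  have int_S: "interior S \<subseteq> interior (range Tavg)"
    using interior_subset_rel_interior[of C] interior_mono[OF S_C] ri_ran
    by (intro interior_maximal) auto
  have split: "S = A j + (\<Sum>i\<in>I - {j}. A i)"
    unfolding S_def using fin assms(6) by (rule sum.remove)
  have int_A: "(\<lambda>x. lam j *\<^sub>R x) ` interior (range (T j)) = interior (A j)"
    unfolding A_def using lam(2)
    by (intro interior_injective_linear_image[symmetric]) (auto simp: inj_on_def linear_scaleR)
  \<comment> \<open>Both (ii) and (iv) rest on this: the summand with index \<open>j\<close> contributes interior points to \<open>S\<close>.\<close>
  have plus: "interior (A j) + closure (\<Sum>i\<in>I - {j}. A i) \<subseteq> interior (range Tavg)"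
    using interior_plus_closure_subset[of "A j" "\<Sum>i\<in>I - {j}. A i"] int_S split by blast
  have "surj Tavg" if "surj (T j)"
  proof -
    have "x \<in> interior (range Tavg)" for x
    proof -
      have "(\<Sum>i\<in>I - {j}. lam i *\<^sub>R T i 0) \<in> (\<Sum>i\<in>I - {j}. A i)" (is "?b \<in> _")
        unfolding set_sum_alt[OF finite_Diff[OF fin]] A_def by blast
      then have "?b \<in> closure (\<Sum>i\<in>I - {j}. A i)"
        using closure_subset by blast
      moreover have "x - ?b = lam j *\<^sub>R ((1 / lam j) *\<^sub>R (x - ?b))"
        using lam(2) by simp
      then have "x - ?b \<in> interior (A j)"
        unfolding int_A[symmetric] that interior_UNIV by (rule image_eqI) simp
      ultimately have "(x - ?b) + ?b \<in> interior (range Tavg)"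
        using plus by blast
      then show ?thesis
        by simp
    qed
    then show ?thesis
      using interior_subset by blast
  qed
  moreover have "0 \<in> closure (range Tavg)" if "0 \<in> (\<Inter>i\<in>I. closure (range (T i)))"
  proof -
    have "0 \<in> closure S"
      unfolding S_def A_def using fin that by (intro zero_in_closure_scaled_sum) auto
    then show ?thesis
      using near by (simp add: nearly_equal_def)
  qed
  moreover have "0 \<in> interior (range Tavg)"
    if "0 \<in> interior (range (T j)) \<inter> (\<Inter>i\<in>I - {j}. closure (range (T i)))"
  proof -
    have "0 \<in> interior (A j)"
      using that int_A by force
    moreover have "0 \<in> closure (\<Sum>i\<in>I - {j}. A i)"
      unfolding A_def using fin that by (intro zero_in_closure_scaled_sum) auto
    ultimately have "0 + 0 \<in> interior (range Tavg)"
      using plus by blast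
    then show ?thesis
      by simp
  qed
  ultimately show ?thesis
    using firm near nearly_convex_between[OF C ri_ran ran_C] by (simp add: S_def A_def)
qed

end
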